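(* For any fixed prime $p$, each of the following three conditions on pairs $(a,b)$ of relatively prime integers $a,b>1$, both coprime to $p$, is satisfied for infinitely many $a$ and $b$: (1) $a\,o_p(a)$ and $b\,o_p(b)$ are relatively prime; (2) $a\,o_p(a)$ is odd, and $b$ is supersingular for $p$; (3) $a$ is supersingular for $p$, and $b\,o_p(b)$ is odd. Moreover, each condition is satisfied for infinitely many primes $a$ and $b$.
   Context: For $n\ge 1$ coprime to $p$, $o_p(n)$ is the multiplicative order of $p$ modulo $n$. A positive integer $n$ coprime to $p$ is called supersingular for $p$ if there is an integer $\nu\geq 1$ with $p^\nu\equiv -1 \pmod n$. "Infinitely many $a$ and $b$" means infinitely many pairs $(a,b)$, and "infinitely many primes $a$ and $b$" means infinitely many pairs $(a,b)$ with $a$ and $b$ both prime. *)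

theory Defs
  imports "HOL-Number_Theory.Number_Theory"
begin

text \<open>
  The multiplicative order \<open>o\<^sub>p(n)\<close> of \<open>p\<close> modulo \<open>n\<close> is \<^term>\<open>ord n p\<close> of the library;
  note the order of its arguments (modulus first).
\<close>

text \<open>The congruence is taken over \<^typ>\<open>int\<close>, where \<open>-1\<close> has its intended meaning.\<close>

definition supersingular :: "nat \<Rightarrow> nat \<Rightarrow> bool" where
  "supersingular p n \<longleftrightarrow>
     n > 0 \<and> coprime n p \<and> (\<exists>\<nu>::nat. \<nu> \<ge> 1 \<and> [int p ^ \<nu> = -1] (mod int n))"

definition admissible_pair :: "nat \<Rightarrow> nat \<Rightarrow> nat \<Rightarrow> bool" where
  "admissible_pair p a b \<longleftrightarrow>
     a > 1 \<and> b > 1 \<and> coprime a b \<and> coprime a p \<and> coprime b p"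

end

theory Submission
  imports Defs
begin

text \<open>
  For every prime \<open>q > p\<close>, a prime divisor \<open>r\<close> of \<open>1 + p + \<dots> + p\<^sup>q\<^sup>-\<^sup>1\<close> has \<open>o\<^sub>p(r) = q\<close>, so that
  \<open>r > q\<close>; hence there are arbitrarily large primes whose order is a large prime. Keeping \<open>b\<close> fixed,
  as such a prime or as a prime divisor of \<open>p + 1\<close>, and letting \<open>a\<close> run through these primes
  yields infinitely many pairs.
\<close>

lemma ex_prime_ord_eq:
  fixes p q :: nat
  assumes "p > 1" "prime q" "q > p"
  shows "\<exists>r. prime r \<and> r > q \<and> ord r p = q"
proof -
  define S where "S = (\<Sum>i<q. p ^ i)"
  have "q > 1"
    using assms by simp
  have "(\<Sum>i\<in>{..<2}. p ^ i) \<le> S"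
    unfolding S_def using \<open>q > 1\<close> by (intro sum_mono2) auto
  then have "S > 1"
    using assms by (simp add: numeral_2_eq_2)
  then obtain r where r: "prime r" "r dvd S"
    using prime_factor_nat[of S] by auto
  have "int p ^ q - 1 = (int p - 1) * int S"
    unfolding S_def using power_diff_1_eq[of "int p" q] by simp
  then have "[int (p ^ q) = int 1] (mod int r)"
    using r by (simp add: cong_iff_dvd_diff)
  then have "ord r p dvd q"
    by (simp only: cong_int_iff ord_divides)
  \<comment> \<open>Order 1 would make every power of \<open>p\<close> congruent to 1 modulo
    \<open>r\<close>, hence \<open>S\<close> congruent to \<open>q\<close>. Then
    \<open>r = q\<close>, and \<open>p\<close> is congruent to 1 modulo \<open>q\<close>, against
    \<open>1 < p < q\<close>.\<close>
  moreover have "ord r p \<noteq> 1"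
  proof
    assume "ord r p = 1"
    then have p1: "[p = 1] (mod r)"
      using ord[of p r] by simp
    have "[S = (\<Sum>i<q. 1 ^ i)] (mod r)"
      unfolding S_def by (intro cong_sum cong_pow p1)
    then have "r dvd q"
      using r cong_dvd_iff[of S q r] by simp
    then have "r = q"
      using r assms by (simp add: primes_dvd_imp_eq)
    then show False
      using p1 assms \<open>q > 1\<close> by (simp add: cong_def)
  qed
  ultimately have o: "ord r p = q"
    using assms by (auto simp: prime_nat_iff)
  \<comment> \<open>By convention \<open>ord r p\<close> is 0 exactly when \<open>r\<close> and
    \<open>p\<close> are not coprime, so a positive order gives coprimality.\<close>
  then have "coprime r p"
    using ord_eq_0[of r p] \<open>q > 1\<close> by auto
  then have "q dvd r - 1"
    using order_divides_totient[of r p] o r by (simp add: totient_prime)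
  then have "r > q"
    using r prime_gt_1_nat[of r] by (auto dest: dvd_imp_le)
  with r o show ?thesis
    by blast
qed

lemma ex_large_prime_ord_prime:
  fixes p N :: nat
  assumes "p > 1"
  shows "\<exists>q r. prime q \<and> prime r \<and> p < q \<and> N < q \<and> q < r \<and> ord r p = q"
proof -
  obtain q where "prime q" "q > max p N"
    using bigger_prime by blast
  with ex_prime_ord_eq[OF assms, of q] show ?thesis
    by auto
qed

text \<open>Since \<open>b\<close> stays fixed, the projection \<open>fst\<close> of the set of
  pairs already contains an unbounded set of naturals.\<close>

lemma infinite_pairsI:
  fixes P :: "nat \<Rightarrow> 'a \<Rightarrow> bool"
  assumes "\<And>N. \<exists>a>N. P a b"
  shows "infinite {(a, b). P a b}"
proof
  assume "finite {(a, b). P a b}"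
  then have "finite (fst ` {(a, b). P a b})"
    by simp
  then have "finite {a. P a b}"
    by (rule rev_finite_subset) force
  then show False
    using assms by (metis infinite_nat_iff_unbounded mem_Collect_eq)
qed

text \<open>Taking the order \<open>q\<close> of the second choice above \<open>b\<close> gives a
  chain \<open>p < s < b < q < a\<close> of primes. Hence \<open>a * q\<close> and
  \<open>b * s\<close> share no prime factor.\<close>

lemma infinite_prime_pairs_coprime_ord:
  assumes "prime p"
  shows "infinite {(a, b). admissible_pair p a b \<and> prime a \<and> prime b \<and>
           coprime (a * ord a p) (b * ord b p)}"
proof -
  have p: "p > 1"
    using assms by (rule prime_gt_1_nat)
  obtain s b where b: "prime s" "prime b" "p < s" "s < b" "ord b p = s"
    using ex_large_prime_ord_prime[OF p] by blast
  show ?thesis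
  proof (rule infinite_pairsI)
    fix N
    obtain q a where a: "prime q" "prime a" "max b N < q" "q < a" "ord a p = q"
      using ex_large_prime_ord_prime[OF p] by blast
    have "coprime a b" "coprime a s" "coprime q b" "coprime q s" "coprime a p" "coprime b p"
      using a b assms by (auto intro!: primes_coprime)
    then show "\<exists>a>N. admissible_pair p a b \<and> prime a \<and> prime b \<and>
        coprime (a * ord a p) (b * ord b p)"
      using a b prime_gt_1_nat by (intro exI[of _ a]) (auto simp: admissible_pair_def)
  qed
qed

text \<open>A prime divisor \<open>b\<close> of \<open>p + 1\<close> is supersingular with exponent
  1, because \<open>p\<close> is congruent to -1 modulo \<open>b\<close>.\<close>

lemma infinite_prime_pairs_odd_supersingular:
  assumes "prime p"
  shows "infinite {(a, b). admissible_pair p a b \<and> prime a \<and> prime b \<and>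
           odd (a * ord a p) \<and> supersingular p b}"
proof -
  have p: "p > 1"
    using assms by (rule prime_gt_1_nat)
  obtain b where b: "prime b" "b dvd p + 1"
    using prime_factor_nat[of "p + 1"] p by auto
  \<comment> \<open>Otherwise \<open>p\<close> would divide both \<open>p\<close> and
    \<open>p + 1\<close>, hence 1.\<close>
  have "b \<noteq> p"
    using b p dvd_add_right_iff[of p p 1] by auto
  then have "coprime b p"
    using b assms by (simp add: primes_coprime)
  moreover have "[int p ^ 1 = -1] (mod int b)"
    using b int_dvd_int_iff[of b "p + 1"] by (simp add: cong_iff_dvd_diff add.commute)
  ultimately have ss: "supersingular p b"
    unfolding supersingular_def using b prime_gt_0_nat by blast
  show ?thesis
  proof (rule infinite_pairsI)
    fix N
    obtain q a where a: "prime q" "prime a" "p < q" "max b N < q" "q < a" "ord a p = q"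
      using ex_large_prime_ord_prime[OF p] by blast
    \<comment> \<open>Both are primes larger than \<open>p\<close>, hence larger than 2; this covers
      \<open>p = 2\<close> as well.\<close>
    have "odd a" "odd q"
      using a p prime_odd_nat[of a] prime_odd_nat[of q] by linarith+
    moreover have "coprime a b" "coprime a p"
      using a b assms by (auto intro!: primes_coprime)
    ultimately show "\<exists>a>N. admissible_pair p a b \<and> prime a \<and> prime b \<and>
        odd (a * ord a p) \<and> supersingular p b"
      using a b ss \<open>coprime b p\<close> prime_gt_1_nat
      by (intro exI[of _ a]) (auto simp: admissible_pair_def)
  qed
qed

theorem lemma6p14:
  fixes p :: nat
  assumes "prime p"
  shows "infinite {(a, b). admissible_pair p a b \<and>
           coprime (a * ord a p) (b * ord b p)} \<and>
         infinite {(a, b). admissible_pair p a b \<and>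
           odd (a * ord a p) \<and> supersingular p b} \<and>
         infinite {(a, b). admissible_pair p a b \<and>
           supersingular p a \<and> odd (b * ord b p)} \<and>
         infinite {(a, b). admissible_pair p a b \<and> prime a \<and> prime b \<and>
           coprime (a * ord a p) (b * ord b p)} \<and>
         infinite {(a, b). admissible_pair p a b \<and> prime a \<and> prime b \<and>
           odd (a * ord a p) \<and> supersingular p b} \<and>
         infinite {(a, b). admissible_pair p a b \<and> prime a \<and> prime b \<and>
           supersingular p a \<and> odd (b * ord b p)}"
proof -
  let ?S1 = "{(a, b). admissible_pair p a b \<and> prime a \<and> prime b \<and>
           coprime (a * ord a p) (b * ord b p)}"
  let ?S2 = "{(a, b). admissible_pair p a b \<and> prime a \<and> prime b \<and>
           odd (a * ord a p) \<and> supersingular p b}"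
  let ?S3 = "{(a, b). admissible_pair p a b \<and> prime a \<and> prime b \<and>
           supersingular p a \<and> odd (b * ord b p)}"
  have S1: "infinite ?S1"
    using assms by (rule infinite_prime_pairs_coprime_ord)
  have S2: "infinite ?S2"
    using assms by (rule infinite_prime_pairs_odd_supersingular)
  \<comment> \<open>Exchanging the components turns condition (2) into condition (3), so a finite
    \<open>?S3\<close> would force \<open>?S2\<close> to be finite.\<close>
  have "?S2 \<subseteq> prod.swap ` ?S3"
    by (force simp: admissible_pair_def coprime_commute)
  with S2 have S3: "infinite ?S3"
    using finite_surj by blast
  show ?thesis
    \<comment> \<open>The sets without the primality requirement contain those with it.\<close>
    by (intro conjI S1 S2 S3 infinite_super[OF _ S1] infinite_super[OF _ S2]
        infinite_super[OF _ S3]) auto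
qed

end
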